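(* Let $r<m$ be positive integers, let $B\in\mathbb{R}^{r\times m}$ have rank $r$, let $\Lambda\in\mathbb{R}^{m\times m}$ be a (constant) diagonal matrix whose diagonal entries lie in $(0,1]$, and let $(v(k))_{k\ge 0}$ be a bounded sequence in $\mathbb{R}^r$. Let $A_m\in\mathbb{R}^{r\times r}$ be a matrix all of whose eigenvalues are inside the unit circle, and let $\ell\in\mathbb{R}$ be such that both pairs $(A_m+\ell I_r,\,B\Lambda)$ and $(A_m-\ell I_r,\,B\Lambda)$ satisfy Assumption 1 (stated in the context). Let $\Gamma=\Gamma^T\in\mathbb{R}^{r\times r}$ be positive definite. With arbitrary initial values $\xi(0),\xi_{m1}(0)\in\mathbb{R}^r$ and $\theta_v(0)\in\mathbb{R}^{r\times m}$, consider for $k=0,1,2,\dots$ $$u(k)=\theta_v^T(k)v(k),\qquad \xi(k+1)=A_m\xi(k)+B\Lambda u(k)-v(k),$$ the closed loop reference model $$\xi_{m1}(k+1)=A_m\xi_{m1}(k)-\ell\big(\xi(k)-\xi_{m1}(k)\big),$$ and the error $e_1(k)=\xi(k)-\xi_{m1}(k)$, which obeys $$e_1(k+1)=(A_m+\ell I_r)e_1(k)+B\Lambda\tilde\theta_v^T(k)v(k).$$ Suppose that the parameter matrix $\theta_v(k)\in\mathbb{R}^{r\times m}$ is updated by $$\theta_v(k+1)=\theta_v(k)+\Gamma v(k)\epsilon^T(k)B,\qquad \epsilon(k)=\frac{v(k)-B\Lambda u(k)}{\sigma^2(k)},$$ $$\sigma(k)=\sqrt{1+\lambda_{\max}(B\Lambda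 B^T)\,v^T(k)\Gamma v(k)}.$$ Then the adaptive parameter $\theta_v(k)$, the error signal $e_1(k)$ and all other signals (that is, $\xi(k)$, $\xi_{m1}(k)$, $u(k)$ and $\epsilon(k)$) remain bounded over $k\ge 0$, and $\lim_{k\to\infty}e_1(k)=0$.
   Context: $\lambda_{\max}(\cdot)$ denotes the maximum eigenvalue of a symmetric matrix and $I_r$ the $r\times r$ identity matrix. The ideal parameter is $\theta_v^*=\big((B\Lambda)^T(B\Lambda\Lambda B^T)^{-1}\big)^T\in\mathbb{R}^{r\times m}$, so that $\theta_v^{*T}$ is the pseudo-inverse of $B\Lambda$, and $\tilde\theta_v(k)=\theta_v(k)-\theta_v^*$. Assumption 1 for a pair $(M,N)$ with $M\in\mathbb{R}^{r\times r}$ and $N\in\mathbb{R}^{r\times m}$: (i) $|\lambda_i(M)|\le 1$ for every eigenvalue $\lambda_i(M)$, $i=1,\dots,r$; (ii) all controllable modes of $(M,N)$ are inside the unit circle (i.e. have modulus strictly less than $1$); (iii) the eigenvalues of $M$ on the unit circle have Jordan blocks of size one. A sequence of vectors or matrices is bounded if the supremum over $k\ge 0$ of the absolute values of all its entries is finite. *)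

theory Defs
  imports "Jordan_Normal_Form.Jordan_Normal_Form" "HOL-Analysis.Analysis"
begin

(* $ always denotes indexing of finite Cartesian products; Jordan_Normal_Form matrices
   occur only through to_jnf_mat. *)
no_notation Matrix.vec_index (infixl "$" 100)

definition complexify :: "real^'n^'m \<Rightarrow> complex^'n^'m" where
  "complexify A = map_matrix complex_of_real A"

definition is_eigenvalue :: "'a::field^'n^'n \<Rightarrow> 'a \<Rightarrow> bool" where
  "is_eigenvalue A l \<longleftrightarrow> (\<exists>x. x \<noteq> 0 \<and> A *v x = l *s x)"

text \<open>Maximum eigenvalue; meaningful for symmetric matrices, whose eigenvalues are all real.\<close>

definition lambda_max :: "real^'n^'n \<Rightarrow> real" where
  "lambda_max S = Max {l. is_eigenvalue S l}"

text \<open>The same matrix in the type used by the Jordan normal form library, with respect to some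
  enumeration of the index type. A different enumeration gives a matrix similar via a permutation,
  so the Jordan normal forms do not depend on it.\<close>

definition to_jnf_mat :: "'a^'n^'n \<Rightarrow> 'a Matrix.mat" where
  "to_jnf_mat A = Matrix.mat CARD('n) CARD('n)
     (\<lambda>(i, j). A $ from_nat_into UNIV i $ from_nat_into UNIV j)"

text \<open>Complexified range of the Kalman matrix $[N, MN, \ldots, M^{r-1}N]$.\<close>

definition controllable_subspace :: "real^'r^'r \<Rightarrow> real^'m^'r \<Rightarrow> (complex^'r) set" where
  "controllable_subspace M N =
     vec.span (\<Union>k<CARD('r). columns (complexify ((((**) M) ^^ k) N)))"

text \<open>The controllable modes are the eigenvalues of the restriction of M to its invariant
  controllable subspace, i.e. of the controllable part in the Kalman decomposition.\<close>

definition controllable_mode :: "real^'r^'r \<Rightarrow> real^'m^'r \<Rightarrow> complex \<Rightarrow> bool" where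
  "controllable_mode M N l \<longleftrightarrow>
     (\<exists>x \<in> controllable_subspace M N. x \<noteq> 0 \<and> complexify M *v x = l *s x)"

definition assumption1 :: "real^'r^'r \<Rightarrow> real^'m^'r \<Rightarrow> bool" where
  "assumption1 M N \<longleftrightarrow>
     (\<forall>l. is_eigenvalue (complexify M) l \<longrightarrow> cmod l \<le> 1) \<and>
     (\<forall>l. controllable_mode M N l \<longrightarrow> cmod l < 1) \<and>
     (\<exists>blocks. jordan_nf (to_jnf_mat (complexify M)) blocks \<and>
        (\<forall>(n, l) \<in> set blocks. cmod l = 1 \<longrightarrow> n = 1))"

definition ideal_parameter :: "real^'m^'r \<Rightarrow> real^'m^'m \<Rightarrow> real^'m^'r" where
  "ideal_parameter B \<Lambda> =
     transpose (transpose (B ** \<Lambda>) ** matrix_inv (B ** \<Lambda> ** \<Lambda> ** transpose B))"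

definition outer :: "real^'r \<Rightarrow> real^'m \<Rightarrow> real^'m^'r" where
  "outer x y = (\<chi> i j. x $ i * y $ j)"

definition bounded_vec_seq :: "(nat \<Rightarrow> real^'n) \<Rightarrow> bool" where
  "bounded_vec_seq x \<longleftrightarrow> bdd_above {\<bar>x k $ i\<bar> | k i. True}"

definition bounded_mat_seq :: "(nat \<Rightarrow> real^'n^'m) \<Rightarrow> bool" where
  "bounded_mat_seq X \<longleftrightarrow> bdd_above {\<bar>X k $ i $ j\<bar> | k i j. True}"

end

theory Submission
  imports Defs "Jordan_Normal_Form.Spectral_Radius"
begin

text \<open>
  Write $w(k) = B\Lambda\tilde\theta_v^T(k) v(k) = B\Lambda u(k) - v(k) = -\sigma^2(k)\epsilon(k)$. Along the
  adaptation law, $V = \mathrm{tr}(\Lambda\tilde\theta_v^T\Gamma^{-1}\tilde\theta_v)$ drops in each step by at least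
  $(\sigma^2 + 1)|\epsilon|^2$, because $\sigma^2 - 1$ dominates $v^T\Gamma v$ times the Rayleigh quotient of
  $B\Lambda B^T$ at $\epsilon$. Hence $\theta_v$ is bounded and $\epsilon(k) \to 0$; as $v$, and with it
  $\sigma$, is bounded, $w(k) \to 0$.
  Since $B\Lambda$ has full row rank, every mode of the pair $(A_m + \ell I, B\Lambda)$ is controllable;
  Assumption 1 then makes $A_m + \ell I$ Schur stable, and $e_1$, which it drives with
  the vanishing input $w$, tends to 0.
\<close>

no_notation Matrix.vec_index (infixl "$" 100)

subsection \<open>Schur stable matrices\<close>

lemma bij_betw_from_nat_into_UNIV:
  "bij_betw (from_nat_into (UNIV :: 'n::finite set)) {..<CARD('n)} UNIV"
  by (rule bij_betw_from_nat_into_finite) simp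

lemma sum_from_nat_into_UNIV:
  "(\<Sum>i = 0..<CARD('n). f (from_nat_into (UNIV :: 'n::finite set) i)) = sum f UNIV"
  using sum.reindex_bij_betw[OF bij_betw_from_nat_into_UNIV, of f] by (simp add: atLeast0LessThan)

lemma from_nat_into_UNIV_surj:
  fixes i :: "'n::finite"
  obtains a where "a < CARD('n)" "from_nat_into UNIV a = i"
proof -
  have "i \<in> from_nat_into UNIV ` {..<CARD('n)}"
    using bij_betw_from_nat_into_UNIV[where 'n='n] unfolding bij_betw_def by blast
  then show ?thesis using that by blast
qed

lemma to_jnf_mat_carrier: "to_jnf_mat (A :: 'a^'n^'n) \<in> carrier_mat CARD('n) CARD('n)"
  by (simp add: to_jnf_mat_def)

lemma to_jnf_mat_mult:
  fixes A C :: "'a::semiring_1^'n^'n"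
  shows "to_jnf_mat (A ** C) = to_jnf_mat A * to_jnf_mat C"
  by (rule eq_matI)
    (auto simp: to_jnf_mat_def matrix_matrix_mult_def scalar_prod_def
      sum_from_nat_into_UNIV[symmetric])

lemma to_jnf_mat_one: "to_jnf_mat (mat 1 :: 'a::semiring_1^'n^'n) = 1\<^sub>m CARD('n)"
proof (rule eq_matI, goal_cases)
  case (1 i j)
  then have "from_nat_into (UNIV :: 'n set) i = from_nat_into UNIV j \<longleftrightarrow> i = j"
    using bij_betw_from_nat_into_UNIV[where 'n='n] by (auto simp: bij_betw_def inj_on_def)
  with 1 show ?case by (simp add: to_jnf_mat_def Finite_Cartesian_Product.mat_def)
qed (simp_all add: to_jnf_mat_def)

text \<open>The library's power appends each new factor on the right, hence the iteration of
  \<open>X ** A\<close>.\<close>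

lemma to_jnf_mat_power:
  fixes A :: "'a::semiring_1^'n^'n"
  shows "to_jnf_mat (((\<lambda>X. X ** A) ^^ k) (mat 1)) = to_jnf_mat A ^\<^sub>m k"
  by (induction k) (simp_all add: to_jnf_mat_one to_jnf_mat_mult, simp add: to_jnf_mat_def)

text \<open>Reindexing along the enumeration carries eigenvectors to eigenvectors in both
  directions. This makes spectral facts of the library available for
  \<open>is_eigenvalue\<close>.\<close>

lemma eigenvalue_to_jnf_mat:
  fixes A :: "'a::field^'n^'n"
  shows "eigenvalue (to_jnf_mat A) = is_eigenvalue A"
proof (intro ext iffI)
  let ?e = "from_nat_into (UNIV :: 'n set)"
  fix z
  assume "eigenvalue (to_jnf_mat A) z"
  then obtain x where x: "x \<in> carrier_vec CARD('n)" "x \<noteq> 0\<^sub>v CARD('n)"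
    and eq: "to_jnf_mat A *\<^sub>v x = z \<cdot>\<^sub>v x"
    by (auto simp: eigenvalue_def eigenvector_def to_jnf_mat_def)
  define h where "h = the_inv_into {..<CARD('n)} ?e"
  have h: "h (?e a) = a" if "a < CARD('n)" for a
    unfolding h_def using bij_betw_from_nat_into_UNIV[where 'n='n] that
    by (intro the_inv_into_f_f) (auto simp: bij_betw_def)
  define y :: "'a^'n" where "y = (\<chi> i. Matrix.vec_index x (h i))"
  have ye: "y $ ?e a = Matrix.vec_index x a" if "a < CARD('n)" for a
    by (simp add: y_def h that)
  have "\<exists>a < CARD('n). Matrix.vec_index x a \<noteq> 0"
    using x by (metis eq_vecI carrier_vecD index_zero_vec)
  then have "y \<noteq> 0" using ye by (metis zero_index)
  moreover have "A *v y = z *s y"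
  proof (subst vec_eq_iff, rule allI)
    fix i
    obtain a where a: "a < CARD('n)" "?e a = i" by (rule from_nat_into_UNIV_surj)
    have "(A *v y) $ i = (\<Sum>b = 0..<CARD('n). A $ i $ ?e b * y $ ?e b)"
      by (simp add: matrix_vector_mult_def
          sum_from_nat_into_UNIV[of "\<lambda>j. A $ i $ j * y $ j"])
    also have "\<dots> = Matrix.vec_index (to_jnf_mat A *\<^sub>v x) a"
      using a x by (auto simp: to_jnf_mat_def scalar_prod_def ye intro!: sum.cong)
    also have "\<dots> = (z *s y) $ i"
      using a x ye[OF a(1)] by (simp add: eq)
    finally show "(A *v y) $ i = (z *s y) $ i" .
  qed
  ultimately show "is_eigenvalue A z" by (auto simp: is_eigenvalue_def)
next
  let ?e = "from_nat_into (UNIV :: 'n set)"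
  fix z
  assume "is_eigenvalue A z"
  then obtain y where y: "y \<noteq> 0" "A *v y = z *s y" by (auto simp: is_eigenvalue_def)
  define x where "x = Matrix.vec CARD('n) (\<lambda>a. y $ ?e a)"
  obtain i where i: "y $ i \<noteq> 0" using y by (auto simp: vec_eq_iff)
  obtain a where a: "a < CARD('n)" "?e a = i" by (rule from_nat_into_UNIV_surj)
  have "Matrix.vec_index x a \<noteq> 0" using a i by (simp add: x_def)
  then have "x \<noteq> 0\<^sub>v CARD('n)" using a by auto
  moreover have "to_jnf_mat A *\<^sub>v x = z \<cdot>\<^sub>v x"
  proof (rule eq_vecI)
    fix b assume "b < dim_vec (z \<cdot>\<^sub>v x)"
    then have b: "b < CARD('n)" by (simp add: x_def)
    have "Matrix.vec_index (to_jnf_mat A *\<^sub>v x) b = (\<Sum>c = 0..<CARD('n). A $ ?e b $ ?e c * y $ ?e c)"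
      using b by (auto simp: to_jnf_mat_def scalar_prod_def x_def intro!: sum.cong)
    also have "\<dots> = (A *v y) $ ?e b"
      by (simp add: matrix_vector_mult_def
          sum_from_nat_into_UNIV[of "\<lambda>j. A $ ?e b $ j * y $ j"])
    finally show "Matrix.vec_index (to_jnf_mat A *\<^sub>v x) b = Matrix.vec_index (z \<cdot>\<^sub>v x) b"
      using b by (simp add: y x_def)
  qed (simp add: to_jnf_mat_def x_def)
  ultimately show "eigenvalue (to_jnf_mat A) z"
    unfolding eigenvalue_def eigenvector_def
    by (intro exI[of _ x]) (simp add: to_jnf_mat_def x_def)
qed

section \<open>Finiteness of the spectrum and power boundedness\<close>

lemma finite_eigenvalues: "finite {z. is_eigenvalue (A :: 'a::field^'n^'n) z}"
  using card_finite_spectrum(1)[OF to_jnf_mat_carrier[of A]]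
  by (simp add: spectrum_def eigenvalue_to_jnf_mat)

text \<open>A finite set of moduli strictly below \<open>b\<close> has its maximum strictly below
  \<open>b\<close>. Inserting 0 makes the set visibly nonempty and the bound nonnegative.\<close>

lemma eigenvalues_less_bound:
  fixes A :: "complex^'n^'n"
  assumes "\<And>z. is_eigenvalue A z \<Longrightarrow> cmod z < b" "0 < b"
  obtains r where "0 \<le> r" "r < b" "\<And>z. is_eigenvalue A z \<Longrightarrow> cmod z \<le> r"
proof
  let ?S = "insert 0 (cmod ` {z. is_eigenvalue A z})"
  have fin: "finite ?S" by (simp add: finite_eigenvalues)
  show "0 \<le> Max ?S" using fin by (intro Max_ge) auto
  show "Max ?S < b" using fin assms by (subst Max_less_iff) auto
  show "cmod z \<le> Max ?S" if "is_eigenvalue A z" for z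
    using fin that by (intro Max_ge) auto
qed

text \<open>The spectral radius is the modulus of an eigenvalue, hence below 1, and then one
  constant bounds the entries of all powers. Passing from entries to norms costs the factor
  \<open>CARD('n)\<close> twice.\<close>

lemma power_bounded_if_eigenvalues_less_1:
  fixes A :: "complex^'n^'n"
  assumes "\<And>z. is_eigenvalue A z \<Longrightarrow> cmod z < 1"
  obtains c where "\<And>k x. norm (((*v) A ^^ k) x) \<le> c * norm x"
proof -
  let ?P = "\<lambda>k. ((\<lambda>X. X ** A) ^^ k) (mat 1)"
  have "spectral_radius (to_jnf_mat A) \<in> norm ` spectrum (to_jnf_mat A)"
    by (rule spectral_radius_mem_max(1)[OF to_jnf_mat_carrier]) simp
  then have "spectral_radius (to_jnf_mat A) < 1"
    using assms by (auto simp: spectrum_def eigenvalue_to_jnf_mat)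
  from spectral_radius_jnf_norm_bound_less_1_upper_triangular[OF to_jnf_mat_carrier this]
  obtain c where c: "\<And>k. norm_bound (to_jnf_mat (?P k)) c"
    by (auto simp: to_jnf_mat_power)
  have entry: "norm (?P k $ i $ j) \<le> c" for k i j
  proof -
    obtain a b where "a < CARD('n)" "from_nat_into UNIV a = i"
      "b < CARD('n)" "from_nat_into UNIV b = j"
      by (metis from_nat_into_UNIV_surj)
    with c[of k] show ?thesis by (auto simp: norm_bound_def to_jnf_mat_def)
  qed
  have pow: "((*v) A ^^ k) x = ?P k *v x" for k x
  proof (induction k arbitrary: x)
    case (Suc k)
    have "((*v) A ^^ Suc k) x = ((*v) A ^^ k) (A *v x)"
      unfolding funpow_Suc_right o_apply ..
    then show ?case
      by (simp add: Suc.IH matrix_vector_mul_assoc)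
  qed simp
  show ?thesis
  proof
    fix k and x :: "complex^'n"
    have "norm (?P k *v x) \<le> (\<Sum>i\<in>UNIV. norm ((?P k *v x) $ i))"
      by (simp add: norm_vec_def L2_set_le_sum)
    also have "\<dots> \<le> (\<Sum>i\<in>(UNIV::'n set). \<Sum>j\<in>(UNIV::'n set). c * norm x)"
      unfolding matrix_vector_mult_def vec_lambda_beta
      by (intro sum_mono order_trans[OF norm_sum] order_trans[OF norm_mult_ineq]
          mult_mono entry Finite_Cartesian_Product.norm_nth_le norm_ge_zero
          order_trans[OF norm_ge_zero entry])
    finally show "norm (((*v) A ^^ k) x) \<le> (real CARD('n) * (real CARD('n) * c)) * norm x"
      by (simp add: pow mult.assoc)
  qed
qed

section \<open>Norms contracted by a Schur stable matrix\<close>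

lemma is_eigenvalue_scaleR:
  fixes A :: "complex^'n^'n"
  assumes "is_eigenvalue (t *\<^sub>R A) z" "t \<noteq> 0"
  shows "is_eigenvalue A (z / of_real t)"
proof -
  obtain x where x: "x \<noteq> 0" "(t *\<^sub>R A) *v x = z *s x" using assms by (auto simp: is_eigenvalue_def)
  have "of_real t * (A *v x) $ i = z * x $ i" for i
    using arg_cong[OF x(2), of "\<lambda>y. y $ i"]
    by (simp add: matrix_vector_mult_def scaleR_conv_of_real[where 'a=complex] sum_distrib_left mult.assoc)
  then have "A *v x = (z / of_real t) *s x"
    using assms(2) by (auto simp: vec_eq_iff field_simps)
  with x(1) show ?thesis by (auto simp: is_eigenvalue_def)
qed

text \<open>The new norm is the supremum of \<open>\<parallel>(A/\<rho>)\<^sup>k x\<parallel>\<close> over \<open>k\<close>, for a \<open>\<rho> < 1\<close> above the spectral radius.\<close>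

lemma adapted_norm_exists:
  fixes A :: "complex^'n^'n"
  assumes "\<And>z. is_eigenvalue A z \<Longrightarrow> cmod z < 1"
  obtains N \<rho> c where "0 < \<rho>" "\<rho> < 1"
    "\<And>x. norm x \<le> N x" "\<And>x. N x \<le> c * norm x"
    "\<And>x y. N (x + y) \<le> N x + N y" "\<And>x. N (A *v x) \<le> \<rho> * N x"
proof -
  obtain r where r: "0 \<le> r" "r < 1" "\<And>z. is_eigenvalue A z \<Longrightarrow> cmod z \<le> r"
    using eigenvalues_less_bound[OF assms] by auto
  \<comment> \<open>The midpoint lies strictly above every eigenvalue modulus, so \<open>A\<close>
    divided by it is still Schur stable. It is positive even for \<open>r = 0\<close>, as the
    division requires.\<close>
  define \<rho> where "\<rho> = (1 + r) / 2"
  have \<rho>: "0 < \<rho>" "\<rho> < 1" "r < \<rho>" using r by (auto simp: \<rho>_def)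
  define Y where "Y = (1 / \<rho>) *\<^sub>R A"
  have "cmod z < 1" if "is_eigenvalue Y z" for z
  proof -
    have "is_eigenvalue A (z / of_real (1 / \<rho>))"
      using is_eigenvalue_scaleR[of "1 / \<rho>" A z] that \<rho> by (simp add: Y_def)
    from r(3)[OF this] have "cmod z * \<rho> \<le> r"
      using \<rho> by (simp add: norm_mult norm_divide)
    then have "cmod z * \<rho> < 1 * \<rho>" using \<rho> by linarith
    then show ?thesis using \<rho>(1) mult_less_cancel_right_pos by blast
  qed
  then obtain c where c: "\<And>k x. norm (((*v) Y ^^ k) x) \<le> c * norm x"
    using power_bounded_if_eigenvalues_less_1[of Y thesis] by blast
  define N where "N x = (SUP k. norm (((*v) Y ^^ k) x))" for x
  have bdd: "bdd_above (range (\<lambda>k. norm (((*v) Y ^^ k) x)))" for x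
    using c by (intro bdd_aboveI2)
  have up: "norm (((*v) Y ^^ k) x) \<le> N x" for k x
    unfolding N_def by (rule cSUP_upper[OF UNIV_I bdd])
  have add: "((*v) Y ^^ k) (x + y) = ((*v) Y ^^ k) x + ((*v) Y ^^ k) y" for k x y
    by (induction k) (simp_all add: matrix_vector_right_distrib)
  show ?thesis
  proof
    show "0 < \<rho>" "\<rho> < 1" using \<rho> by auto
    show "norm x \<le> N x" for x using up[of 0] by simp
    show "N x \<le> c * norm x" for x
      unfolding N_def using c by (intro cSUP_least) auto
    show "N (x + y) \<le> N x + N y" for x y
      unfolding N_def[of "x + y"]
      by (rule cSUP_least) (auto simp: add intro: order_trans[OF norm_triangle_ineq] add_mono up)
    show "N (A *v x) \<le> \<rho> * N x" for x
      unfolding N_def[of "A *v x"]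
    proof (rule cSUP_least)
      fix k
      have sc: "((*v) Y ^^ k) (t *\<^sub>R y) = t *\<^sub>R ((*v) Y ^^ k) y" for t y
        by (induction k)
            (simp_all add: vec_eq_iff matrix_vector_mult_def scaleR_sum_right)
      have "A *v x = \<rho> *\<^sub>R (Y *v x)"
        using \<rho>
        by (simp add: Y_def vec_eq_iff matrix_vector_mult_def scaleR_sum_right[symmetric])
      \<comment> \<open>Applying \<open>A\<close> costs the factor \<open>\<rho>\<close> and shifts
        the iterate by one; the shifted iterate is still among those in the supremum
        \<open>N x\<close>.\<close>
      then have "((*v) Y ^^ k) (A *v x) = \<rho> *\<^sub>R ((*v) Y ^^ Suc k) x"
        by (simp add: sc funpow_swap1)
      then show "norm (((*v) Y ^^ k) (A *v x)) \<le> \<rho> * N x"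
        using up[of "Suc k" x] \<rho> by (simp del: funpow.simps)
    qed simp
  qed
qed

text \<open>The isometric embedding \<open>h\<close> of real into complex vectors intertwines
  \<open>M\<close> with its complexification, so the complex norm pulls back.\<close>

lemma adapted_norm_exists_real:
  fixes M :: "real^'n^'n"
  assumes "\<And>z. is_eigenvalue (complexify M) z \<Longrightarrow> cmod z < 1"
  obtains N \<rho> c where "0 < \<rho>" "\<rho> < 1"
    "\<And>x. norm x \<le> N x" "\<And>x. N x \<le> c * norm x"
    "\<And>x y. N (x + y) \<le> N x + N y" "\<And>x. N (M *v x) \<le> \<rho> * N x"
proof -
  define h :: "real^'n \<Rightarrow> complex^'n" where "h x = (\<chi> i. complex_of_real (x $ i))" for x
  have norm_h: "norm (h x) = norm x" for x
    by (simp add: h_def norm_vec_def)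
  have add_h: "h (x + y) = h x + h y" for x y
    by (simp add: h_def vec_eq_iff)
  have mult_h: "h (M *v x) = complexify M *v h x" for x
    by (simp add: h_def vec_eq_iff matrix_vector_mult_def complexify_def)
  obtain N \<rho> c where N: "0 < \<rho>" "\<rho> < 1"
    "\<And>x. norm x \<le> N x" "\<And>x. N x \<le> c * norm x"
    "\<And>x y. N (x + y) \<le> N x + N y" "\<And>x. N (complexify M *v x) \<le> \<rho> * N x"
    using adapted_norm_exists[of "complexify M" thesis] assms by blast
  show ?thesis
  proof (rule that[of \<rho> "\<lambda>x. N (h x)" c])
    show "norm x \<le> N (h x)" for x using N(3)[of "h x"] by (simp add: norm_h)
    show "N (h x) \<le> c * norm x" for x using N(4)[of "h x"] by (simp add: norm_h)
  qed (simp_all add: N add_h mult_h)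
qed

section \<open>Contractive recursions\<close>

lemma contraction_recursion_bounded:
  fixes a :: "nat \<Rightarrow> real"
  assumes "\<And>k. a (Suc k) \<le> \<rho> * a k + d" "0 < \<rho>" "\<rho> < 1"
  shows "a k \<le> max (a 0) (d / (1 - \<rho>))"
proof (induction k)
  case (Suc k)
  \<comment> \<open>\<open>d / (1 - \<rho>)\<close> is the fixed point of the affine map, and any
    level at or above it is not exceeded after one step.\<close>
  let ?m = "max (a 0) (d / (1 - \<rho>))"
  have "d \<le> (1 - \<rho>) * ?m"
    using \<open>\<rho> < 1\<close> by (subst mult.commute, subst pos_divide_le_eq[symmetric]) auto
  moreover have "\<rho> * a k \<le> \<rho> * ?m" using Suc assms by (intro mult_left_mono) auto
  ultimately show ?case using assms(1)[of k] by (simp add: algebra_simps)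
qed simp

lemma contraction_recursion_tendsto_0:
  fixes a d :: "nat \<Rightarrow> real"
  assumes rec: "\<And>k. a (Suc k) \<le> \<rho> * a k + d k" and "0 < \<rho>" "\<rho> < 1"
    and "\<And>k. 0 \<le> a k" "d \<longlonglongrightarrow> 0"
  shows "a \<longlonglongrightarrow> 0"
proof (rule LIMSEQ_I)
  fix e :: real assume e: "0 < e"
  \<comment> \<open>A constant input of this size has the fixed point \<open>e / 2\<close>; the
    other half of \<open>e\<close> absorbs the decaying term
    \<open>\<rho> ^ n * a K\<close>.\<close>
  then have "0 < (1 - \<rho>) * (e / 2)" using assms by simp
  from order_tendstoD(2)[OF assms(5) this]
  obtain K where K: "\<And>k. k \<ge> K \<Longrightarrow> d k < (1 - \<rho>) * (e / 2)"
    unfolding eventually_sequentially by blast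
  have tail: "a (K + n) \<le> \<rho> ^ n * a K + e / 2" for n
  proof (induction n)
    case 0
    show ?case using e by simp
  next
    case (Suc n)
    have "a (K + Suc n) \<le> \<rho> * a (K + n) + d (K + n)" using rec[of "K + n"] by simp
    also have "\<dots> \<le> \<rho> * (\<rho> ^ n * a K + e / 2) + (1 - \<rho>) * (e / 2)"
      using Suc K[of "K + n"] assms by (intro add_mono mult_left_mono) auto
    finally show ?case by (simp add: field_simps)
  qed
  have "(\<lambda>n. \<rho> ^ n * a K) \<longlonglongrightarrow> 0"
    using assms by (intro tendsto_mult_left_zero LIMSEQ_realpow_zero) auto
  from order_tendstoD(2)[OF this, of "e / 2"] e
  obtain L where L: "\<And>n. n \<ge> L \<Longrightarrow> \<rho> ^ n * a K < e / 2"
    unfolding eventually_sequentially by auto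
  have "norm (a k - 0) < e" if "k \<ge> K + L" for k
    using tail[of "k - K"] L[of "k - K"] that assms(4)[of k] by force
  then show "\<exists>k0. \<forall>k\<ge>k0. norm (a k - 0) < e" by blast
qed

text \<open>In the adapted norm the recursion becomes a scalar contraction driven by a multiple of
  \<open>norm (w k)\<close>. As this norm dominates the Euclidean one, bounds and limits pass back
  to \<open>x\<close>.\<close>

lemma stable_recursion:
  fixes M :: "real^'n^'n" and x w :: "nat \<Rightarrow> real^'n"
  assumes "\<And>z. is_eigenvalue (complexify M) z \<Longrightarrow> cmod z < 1"
    and rec: "\<And>k. x (Suc k) = M *v x k + w k"
  shows stable_recursion_Bseq: "Bseq w \<Longrightarrow> Bseq x"
    and stable_recursion_tendsto_0: "w \<longlonglongrightarrow> 0 \<Longrightarrow> x \<longlonglongrightarrow> 0"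
proof -
  obtain N \<rho> c where N: "0 < \<rho>" "\<rho> < 1"
    "\<And>x. norm x \<le> N x" "\<And>x. N x \<le> c * norm x"
    "\<And>x y. N (x + y) \<le> N x + N y" "\<And>x. N (M *v x) \<le> \<rho> * N x"
    using adapted_norm_exists_real[of M thesis] assms(1) by blast
  have "c * norm y \<le> \<bar>c\<bar> * norm y" for y :: "real^'n" by (simp add: mult_right_mono)
  then have step: "N (x (Suc k)) \<le> \<rho> * N (x k) + \<bar>c\<bar> * norm (w k)" for k
    using N(5)[of "M *v x k" "w k"] N(6)[of "x k"] N(4)[of "w k"] by (smt (verit) rec)
  show "Bseq x" if w: "Bseq w"
  proof -
    obtain b where b: "\<And>k. norm (w k) \<le> b" using BseqD[OF w] by blast
    have "N (x (Suc k)) \<le> \<rho> * N (x k) + \<bar>c\<bar> * b" for k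
      using step[of k] mult_left_mono[OF b[of k], of "\<bar>c\<bar>"] by simp
    from contraction_recursion_bounded[of "\<lambda>k. N (x k)", OF this N(1,2)]
    show ?thesis by (intro BseqI') (rule order_trans[OF N(3)])
  qed
  show "x \<longlonglongrightarrow> 0" if "w \<longlonglongrightarrow> 0"
  proof -
    have "(\<lambda>k. N (x k)) \<longlonglongrightarrow> 0"
    proof (rule contraction_recursion_tendsto_0[of "\<lambda>k. N (x k)", OF step N(1,2)])
      show "0 \<le> N (x k)" for k using order_trans[OF norm_ge_zero N(3)] .
      show "(\<lambda>k. \<bar>c\<bar> * norm (w k)) \<longlonglongrightarrow> 0"
        using that by (intro tendsto_mult_right_zero tendsto_norm_zero)
    qed
    then show ?thesis
      by (rule Lim_null_comparison[rotated]) (simp add: N(3))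
  qed
qed

subsection \<open>Rayleigh quotients\<close>

text \<open>The quadratic form is continuous on the compact unit sphere and homogeneous of degree
  two, so its minimum there bounds it everywhere.\<close>

lemma rayleigh_min_attained:
  fixes S :: "real^'n^'n"
  obtains x0 where "norm x0 = 1" "\<And>x. (x0 \<bullet> (S *v x0)) * (x \<bullet> x) \<le> x \<bullet> (S *v x)"
proof -
  have "continuous_on (sphere (0::real^'n) 1) (\<lambda>x. x \<bullet> (S *v x))"
    by (intro continuous_intros matrix_vector_mult_linear_continuous_on)
  moreover have "sphere (0::real^'n) 1 \<noteq> {}" by simp
  ultimately obtain x0 :: "real^'n" where "x0 \<in> sphere 0 1"
    and "\<forall>y\<in>sphere 0 1. x0 \<bullet> (S *v x0) \<le> y \<bullet> (S *v y)"
    using continuous_attains_inf[OF compact_sphere] by meson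
  then have x0: "norm x0 = 1"
    and min: "\<And>y. norm y = 1 \<Longrightarrow> x0 \<bullet> (S *v x0) \<le> y \<bullet> (S *v y)"
    by auto
  show ?thesis
  proof (rule that[OF x0])
    fix x :: "real^'n"
    show "(x0 \<bullet> (S *v x0)) * (x \<bullet> x) \<le> x \<bullet> (S *v x)"
    proof (cases "x = 0")
      case False
      define y where "y = x /\<^sub>R norm x"
      have x: "x = norm x *\<^sub>R y" and "norm y = 1" using False by (auto simp: y_def)
      have "(t *\<^sub>R y) \<bullet> (S *v (t *\<^sub>R y)) = t\<^sup>2 * (y \<bullet> (S *v y))" for t
        by (simp add: matrix_vector_mult_scaleR power2_eq_square)
      from this[of "norm x"] have "x \<bullet> (S *v x) = (norm x)\<^sup>2 * (y \<bullet> (S *v y))"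
        unfolding x[symmetric] .
      then show ?thesis
        using mult_left_mono[OF min[OF \<open>norm y = 1\<close>], of "(norm x)\<^sup>2"]
        by (simp add: power2_norm_eq_inner mult.commute)
    qed simp
  qed
qed

text \<open>The minimum over the unit sphere serves as \<open>g\<close>; it is positive because it
  is attained at a nonzero vector.\<close>

lemma positive_definite_coercive:
  fixes S :: "real^'n^'n"
  assumes "\<And>x. x \<noteq> 0 \<Longrightarrow> 0 < x \<bullet> (S *v x)"
  obtains g where "0 < g" "\<And>x. g * (x \<bullet> x) \<le> x \<bullet> (S *v x)"
proof -
  obtain x0 where "norm x0 = 1" "\<And>x. (x0 \<bullet> (S *v x0)) * (x \<bullet> x) \<le> x \<bullet> (S *v x)"
    using rayleigh_min_attained[of S thesis] by blast
  with that[of "x0 \<bullet> (S *v x0)"] assms[of x0] show thesis by force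
qed

lemma inner_symmetric_matrix:
  fixes S :: "real^'n^'n"
  assumes "transpose S = S"
  shows "x \<bullet> (S *v y) = y \<bullet> (S *v x)"
  by (metis assms dot_lmul_matrix inner_commute transpose_matrix_vector)

text \<open>A maximizer of the Rayleigh quotient is an eigenvector, so the maximum is at most
  \<open>lambda_max\<close>.\<close>

lemma rayleigh_le_lambda_max:
  fixes S :: "real^'n^'n"
  assumes sym: "transpose S = S"
  shows "x \<bullet> (S *v x) \<le> lambda_max S * (x \<bullet> x)"
proof -
  \<comment> \<open>The maximizer for \<open>S\<close> is obtained as the minimizer for its
    negative.\<close>
  have neg: "((-1) *\<^sub>R S) *v y = - (S *v y)" for y
    by (simp only: scaleR_matrix_vector_assoc[symmetric]) simp
  obtain x0 where x0: "norm x0 = 1"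
    and "\<And>x. (x0 \<bullet> (((-1) *\<^sub>R S) *v x0)) * (x \<bullet> x) \<le> x \<bullet> (((-1) *\<^sub>R S) *v x)"
    using rayleigh_min_attained[of "(-1) *\<^sub>R S" thesis] by blast
  then have max: "x \<bullet> (S *v x) \<le> (x0 \<bullet> (S *v x0)) * (x \<bullet> x)" for x
    unfolding neg by simp
  define m where "m = x0 \<bullet> (S *v x0)"
  \<comment> \<open>The residual of the eigenvalue equation at the maximizer, to be shown to
    vanish.\<close>
  define g where "g = S *v x0 - m *\<^sub>R x0"
  have x0x0: "x0 \<bullet> x0 = 1" using x0 by (simp add: norm_eq_1)
  \<comment> \<open>Maximality tested at \<open>x0 + t *\<^sub>R g\<close>: the first-order gain
    cannot exceed the second-order loss.\<close>
  have quad: "2 * t * (g \<bullet> g) \<le> t\<^sup>2 * (m * (g \<bullet> g) - g \<bullet> (S *v g))" for t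
  proof -
    have "g \<bullet> g = g \<bullet> (S *v x0) - m * (g \<bullet> x0)"
      by (subst (2) g_def) (simp add: inner_diff_right)
    then have "g \<bullet> (S *v x0) = g \<bullet> g + m * (g \<bullet> x0)" by simp
    then have "m * (t * (g \<bullet> x0 * 2)) = 2 * t * (g \<bullet> (S *v x0)) - 2 * t * (g \<bullet> g)"
      by (simp only:) (simp add: algebra_simps)
    moreover have "x0 \<bullet> (S *v g) = g \<bullet> (S *v x0)" by (rule inner_symmetric_matrix[OF sym])
    ultimately show ?thesis
      using max[of "x0 + t *\<^sub>R g"] x0x0 unfolding m_def[symmetric]
      by (simp add: matrix_vector_right_distrib matrix_vector_mult_scaleR inner_add_left
          inner_add_right inner_commute[of x0 g] m_def[symmetric] algebra_simps power2_eq_square)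
  qed
  have "g \<bullet> g = 0"
  proof (rule ccontr)
    assume ne: "g \<bullet> g \<noteq> 0"
    then have pos: "0 < g \<bullet> g" using inner_ge_zero[of g] by linarith
    let ?q = "m * (g \<bullet> g) - g \<bullet> (S *v g)"
    have q: "0 \<le> ?q" using max[of g] by (simp add: m_def)
    \<comment> \<open>Small enough that \<open>t * ?q\<close> stays below
      \<open>g \<bullet> g\<close>, whereas \<open>quad\<close> divided by \<open>t\<close> asks for
      at least twice that. The 1 keeps the denominator positive.\<close>
    define t where "t = (g \<bullet> g) / (?q + 1)"
    have t: "0 < t" "t * (?q + 1) = g \<bullet> g" using pos q by (auto simp: t_def)
    have "t * (2 * (g \<bullet> g)) \<le> t * (t * ?q)"
      using quad[of t] by (simp add: power2_eq_square algebra_simps)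
    then have "2 * (g \<bullet> g) \<le> t * ?q" using t by simp
    moreover have "t * ?q < g \<bullet> g" using t by (simp add: algebra_simps)
    ultimately show False using pos by linarith
  qed
  then have "S *v x0 = m *s x0" by (simp add: g_def scalar_mult_eq_scaleR)
  moreover have "x0 \<noteq> 0" using x0 by auto
  ultimately have "is_eigenvalue S m" by (auto simp: is_eigenvalue_def)
  then have "m \<le> lambda_max S"
    unfolding lambda_max_def by (intro Max_ge finite_eigenvalues) simp
  then have "m * (x \<bullet> x) \<le> lambda_max S * (x \<bullet> x)" by (intro mult_right_mono) auto
  with max[of x] show ?thesis by (simp add: m_def)
qed

subsection \<open>Bounded sequences\<close>

text \<open>Entries and Euclidean norm bound each other up to the dimension; signals can then be
  handled with \<open>Bseq\<close>.\<close>

lemma bounded_vec_seq_iff_Bseq: "bounded_vec_seq x \<longleftrightarrow> Bseq x"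
proof
  assume "bounded_vec_seq x"
  then obtain b where b: "\<And>k i. \<bar>x k $ i\<bar> \<le> b"
    unfolding bounded_vec_seq_def bdd_above_def by blast
  have "norm (x k) \<le> real CARD('a) * b" for k
    using norm_le_l1_cart[of "x k"] sum_mono[of UNIV "\<lambda>i. \<bar>x k $ i\<bar>" "\<lambda>_. b"] b by simp
  then show "Bseq x" by (rule BseqI')
next
  assume "Bseq x"
  then obtain b where "\<And>k. norm (x k) \<le> b" using BseqD by blast
  then have "\<bar>x k $ i\<bar> \<le> b" for k i
    by (rule order_trans[OF component_le_norm_cart])
  then show "bounded_vec_seq x" unfolding bounded_vec_seq_def by (intro bdd_aboveI[of _ b]) auto
qed

lemma bounded_mat_seq_iff: "bounded_mat_seq X \<longleftrightarrow> (\<exists>b. \<forall>k i j. \<bar>X k $ i $ j\<bar> \<le> b)"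
  unfolding bounded_mat_seq_def bdd_above_def by blast

lemma bounded_mat_seq_transpose: "bounded_mat_seq X \<Longrightarrow> bounded_mat_seq (\<lambda>k. transpose (X k))"
  unfolding bounded_mat_seq_iff Finite_Cartesian_Product.transpose_def by auto

lemma bounded_mat_seq_add_const:
  assumes "bounded_mat_seq (\<lambda>k. X k - C)"
  shows "bounded_mat_seq X"
proof -
  obtain b where b: "\<And>k i j. \<bar>X k $ i $ j - C $ i $ j\<bar> \<le> b"
    using assms unfolding bounded_mat_seq_iff by auto
  have C: "\<bar>C $ i $ j\<bar> \<le> norm C" for i j
    by (rule order_trans[OF component_le_norm_cart Finite_Cartesian_Product.norm_nth_le])
  have "\<bar>X k $ i $ j\<bar> \<le> b + norm C" for k i j
    using b[of k i j] C[of i j] by linarith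
  then show ?thesis unfolding bounded_mat_seq_iff by blast
qed

lemma Bseq_matrix_vector_mult:
  fixes X :: "nat \<Rightarrow> real^'b^'a"
  assumes "bounded_mat_seq X" "Bseq x"
  shows "Bseq (\<lambda>k. X k *v x k)"
proof -
  obtain b where b: "\<And>k i j. \<bar>X k $ i $ j\<bar> \<le> b"
    using assms(1) unfolding bounded_mat_seq_iff by auto
  obtain d where d: "\<And>k i. \<bar>x k $ i\<bar> \<le> d"
    using assms(2) unfolding bounded_vec_seq_iff_Bseq[symmetric] bounded_vec_seq_def bdd_above_def
    by blast
  have "\<bar>(X k *v x k) $ i\<bar> \<le> real CARD('b) * (b * d)" for k i
  proof -
    have "\<bar>(X k *v x k) $ i\<bar> \<le> (\<Sum>j\<in>(UNIV::'b set). \<bar>X k $ i $ j * x k $ j\<bar>)"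
      by (simp add: matrix_vector_mult_def sum_abs)
    also have "\<dots> \<le> (\<Sum>j\<in>(UNIV::'b set). b * d)"
      unfolding abs_mult
      by (intro sum_mono mult_mono b d abs_ge_zero order_trans[OF abs_ge_zero b])
    finally show ?thesis by simp
  qed
  then show ?thesis
    unfolding bounded_vec_seq_iff_Bseq[symmetric] bounded_vec_seq_def bdd_above_def by blast
qed

lemma Bseq_const_matrix_vector_mult: "Bseq x \<Longrightarrow> Bseq (\<lambda>k. (A :: real^'n^'m) *v x k)"
  by (rule Bseq_matrix_vector_mult)
    (auto simp: bounded_mat_seq_iff intro!: exI[of _ "norm A"]
      order_trans[OF component_le_norm_cart Finite_Cartesian_Product.norm_nth_le])

lemma Bseq_plus: "Bseq f \<Longrightarrow> Bseq g \<Longrightarrow> Bseq (\<lambda>k. f k + g k :: 'a::real_normed_vector)"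
  by (elim BseqE) (rule BseqI', rule norm_triangle_mono, auto)

lemma Bseq_diff: "Bseq f \<Longrightarrow> Bseq g \<Longrightarrow> Bseq (\<lambda>k. f k - g k :: 'a::real_normed_vector)"
  using Bseq_plus[of f "\<lambda>k. - g k"] by (simp add: Bseq_minus_iff)

subsection \<open>The ideal parameter and controllability\<close>

lemma diagonal_matrix_vector_mult:
  fixes D :: "real^'n^'n"
  assumes "\<forall>i j. i \<noteq> j \<longrightarrow> D $ i $ j = 0"
  shows "(D *v x) $ i = D $ i $ i * x $ i"
proof -
  have "(D *v x) $ i = (\<Sum>j\<in>UNIV. if j = i then D $ i $ i * x $ i else 0)"
    unfolding matrix_vector_mult_def vec_lambda_beta
    by (intro sum.cong refl) (use assms in auto)
  then show ?thesis by simp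
qed

lemma transpose_diagonal:
  assumes "\<forall>i j. i \<noteq> j \<longrightarrow> D $ i $ j = 0"
  shows "transpose D = D"
  unfolding Finite_Cartesian_Product.transpose_def vec_eq_iff using assms by (metis vec_lambda_beta)

text \<open>Write \<open>P\<close> for \<open>B ** \<Lambda>\<close>. A kernel vector
  \<open>y\<close> of \<open>P P^T\<close> satisfies \<open>|P^T y|^2 = 0\<close>, and
  \<open>P^T = \<Lambda> B^T\<close> is injective by the positive diagonal and the full row rank of
  \<open>B\<close>. So \<open>matrix_inv\<close> yields a true inverse.\<close>

lemma ideal_parameter_right_inverse:
  fixes B :: "real^'m^'r" and \<Lambda> :: "real^'m^'m"
  assumes rank: "rank B = CARD('r)"
    and diag: "\<forall>i j. i \<noteq> j \<longrightarrow> \<Lambda> $ i $ j = 0" and pos: "\<And>i. 0 < \<Lambda> $ i $ i"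
  shows "(B ** \<Lambda>) *v (transpose (ideal_parameter B \<Lambda>) *v x) = x"
proof -
  let ?P = "B ** \<Lambda>"
  let ?K = "B ** \<Lambda> ** \<Lambda> ** transpose B"
  have K: "?K = ?P ** transpose ?P"
    by (simp add: matrix_transpose_mul transpose_diagonal[OF diag] matrix_mul_assoc)
  have "y = 0" if "?K *v y = 0" for y
  proof -
    have "(transpose ?P *v y) \<bullet> (transpose ?P *v y) = y \<bullet> (?K *v y)"
      unfolding K by (metis dot_lmul_matrix matrix_vector_mul_assoc transpose_matrix_vector)
    then have "transpose ?P *v y = 0" using that by simp
    then have "\<Lambda> *v (transpose B *v y) = 0"
      by (simp add: matrix_transpose_mul transpose_diagonal[OF diag] matrix_vector_mul_assoc
          del: transpose_matrix_vector)
    then have "\<Lambda> $ i $ i * (transpose B *v y) $ i = 0" for i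
      by (metis diagonal_matrix_vector_mult[OF diag] zero_index)
    then have "transpose B *v y = 0" using pos by (auto simp: vec_eq_iff less_le)
    moreover have "inj ((*v) (transpose B))"
      using rank by (simp add: full_rank_injective[symmetric] rank_transpose)
    ultimately show "y = 0" by (metis injD matrix_vector_mult_0_right)
  qed
  then have "invertible ?K"
    by (simp add: invertible_left_inverse matrix_left_invertible_ker)
  then have "?K ** matrix_inv ?K = mat 1"
    unfolding matrix_inv_def invertible_def by (metis (mono_tags, lifting) someI_ex)
  then have "?P ** transpose (ideal_parameter B \<Lambda>) = mat 1"
    by (simp add: ideal_parameter_def K transpose_transpose matrix_mul_assoc)
  then show ?thesis by (simp add: matrix_vector_mul_assoc del: transpose_matrix_vector)
qed

lemma complexify_mult: "complexify (A ** C) = complexify A ** complexify C"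
  by (simp add: complexify_def vec_eq_iff matrix_matrix_mult_def)

lemma complexify_mat_1: "complexify (mat 1 :: real^'n^'n) = mat 1"
  by (simp add: complexify_def vec_eq_iff Finite_Cartesian_Product.mat_def)

text \<open>The Kalman block with exponent 0 already spans everything: \<open>x = N (R x)\<close>
  lies in the column space of \<open>N\<close>, also over the complex numbers.\<close>

lemma controllable_subspace_UNIV:
  fixes M :: "real^'r^'r" and N :: "real^'m^'r"
  assumes "N ** R = mat 1"
  shows "controllable_subspace M N = UNIV"
proof -
  have "x \<in> vec.span (columns (complexify N))" for x
  proof -
    have "complexify N *v (complexify R *v x) = x"
      by (simp add: matrix_vector_mul_assoc complexify_mult[symmetric] assms complexify_mat_1)
    then show ?thesis by (metis matrix_vector_mult_in_columnspace_gen)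
  qed
  moreover have "vec.span (columns (complexify N)) \<subseteq> controllable_subspace M N"
    unfolding controllable_subspace_def by (intro vec.span_mono) (auto intro!: bexI[of _ 0])
  ultimately show ?thesis by blast
qed

subsection \<open>The Lyapunov function\<close>

text \<open>Exhibits the adaptation step as a rank-one update that moves every column of the
  parameter along \<open>\<Gamma> *v x\<close>.\<close>

lemma outer_sandwich:
  fixes \<Gamma> :: "real^'r^'r" and B :: "real^'m^'r"
  shows "\<Gamma> ** outer x e ** B = outer (\<Gamma> *v x) (transpose B *v e)"
proof -
  have "\<Gamma> ** outer x e = outer (\<Gamma> *v x) e"
    by (simp add: vec_eq_iff matrix_matrix_mult_def matrix_vector_mult_def outer_def
        sum_distrib_right mult.assoc)
  moreover have "outer y e ** B = outer y (transpose B *v e)" for y :: "real^'r"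
    by (simp add: vec_eq_iff matrix_matrix_mult_def vector_matrix_mult_def outer_def
        sum_distrib_left mult_ac)
  ultimately show ?thesis by simp
qed

lemma inner_diagonal_sum:
  fixes D :: "real^'n^'n"
  assumes "\<forall>i j. i \<noteq> j \<longrightarrow> D $ i $ j = 0"
  shows "x \<bullet> (D *v y) = (\<Sum>j\<in>UNIV. D $ j $ j * (x $ j * y $ j))"
  by (simp add: inner_vec_def diagonal_matrix_vector_mult[OF assms] mult_ac)

text \<open>\<open>lyapunov \<Lambda> G X\<close> is $\mathrm{tr}(\Lambda X^T G X)$ for diagonal $\Lambda$, written as a sum
  over the columns of $X$.\<close>

definition lyapunov :: "real^'m^'m \<Rightarrow> real^'r^'r \<Rightarrow> real^'m^'r \<Rightarrow> real" where
  "lyapunov \<Lambda> G X = (\<Sum>j\<in>UNIV. \<Lambda> $ j $ j * (column j X \<bullet> (G *v column j X)))"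

text \<open>Column \<open>j\<close> moves by \<open>(B^T e)_j\<close> times
  \<open>\<Gamma> v\<close>. Since \<open>G\<close> inverts \<open>\<Gamma>\<close>, cross terms
  become inner products with \<open>v\<close> and quadratic terms become
  \<open>v^T \<Gamma> v\<close>; the weighted sum over \<open>j\<close> reassembles both.\<close>

lemma lyapunov_update:
  fixes B :: "real^'m^'r" and \<Lambda> :: "real^'m^'m" and G \<Gamma> :: "real^'r^'r"
  assumes diag: "\<forall>i j. i \<noteq> j \<longrightarrow> \<Lambda> $ i $ j = 0"
    and G: "transpose G = G" "G ** \<Gamma> = mat 1"
  shows "lyapunov \<Lambda> G (X + \<Gamma> ** outer v e ** B) =
    lyapunov \<Lambda> G X + 2 * (e \<bullet> ((B ** \<Lambda>) *v (transpose X *v v)))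
      + (v \<bullet> (\<Gamma> *v v)) * (e \<bullet> ((B ** \<Lambda> ** transpose B) *v e))"
proof -
  define c where "c = transpose B *v e"
  define q where "q = transpose X *v v"
  have q: "q $ j = column j X \<bullet> v" for j
    by (simp add: q_def matrix_vector_mult_def Finite_Cartesian_Product.transpose_def
        column_def inner_vec_def)
  have G\<Gamma>: "G *v (\<Gamma> *v y) = y" for y by (simp add: matrix_vector_mul_assoc G)
  have col: "column j (X + \<Gamma> ** outer v e ** B) = column j X + c $ j *\<^sub>R (\<Gamma> *v v)" for j
    unfolding outer_sandwich by (simp add: vec_eq_iff column_def outer_def c_def mult.commute)
  have adj: "(transpose B *v e) \<bullet> z = e \<bullet> (B *v z)" for z
    by (metis dot_lmul_matrix transpose_matrix_vector)
  have e1: "e \<bullet> ((B ** \<Lambda>) *v q) = (\<Sum>j\<in>UNIV. \<Lambda> $ j $ j * (c $ j * q $ j))"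
    unfolding inner_diagonal_sum[OF diag, symmetric] unfolding c_def adj
    by (simp add: matrix_vector_mul_assoc del: transpose_matrix_vector)
  have e2: "e \<bullet> ((B ** \<Lambda> ** transpose B) *v e) = (\<Sum>j\<in>UNIV. \<Lambda> $ j $ j * (c $ j * c $ j))"
    unfolding inner_diagonal_sum[OF diag, symmetric] unfolding c_def adj
    by (simp add: matrix_vector_mul_assoc matrix_mul_assoc del: transpose_matrix_vector)
  have "(x + t *\<^sub>R (\<Gamma> *v v)) \<bullet> (G *v (x + t *\<^sub>R (\<Gamma> *v v)))
      = x \<bullet> (G *v x) + 2 * (t * (x \<bullet> v)) + (v \<bullet> (\<Gamma> *v v)) * (t * t)" for x t
    using inner_symmetric_matrix[OF G(1), of "\<Gamma> *v v" x]
    by (simp add: matrix_vector_right_distrib matrix_vector_mult_scaleR G\<Gamma> inner_add_left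
        inner_add_right inner_commute[of "\<Gamma> *v v" v] algebra_simps)
  then show ?thesis
    unfolding lyapunov_def col q_def[symmetric] e1 e2
    by (simp add: q[symmetric] distrib_left sum.distrib sum_distrib_left mult_ac)
qed

text \<open>All summands are nonnegative, so one column is below the sum, and coercivity of
  \<open>G\<close> reduces it to one entry.\<close>

lemma lyapunov_lower_bound:
  fixes \<Lambda> :: "real^'m^'m" and G :: "real^'r^'r"
  assumes "\<And>i. 0 < \<Lambda> $ i $ i" and "0 < g" and "\<And>x. g * (x \<bullet> x) \<le> x \<bullet> (G *v x)"
  shows "\<Lambda> $ j $ j * (g * (X $ i $ j)\<^sup>2) \<le> lyapunov \<Lambda> G X"
proof -
  have nonneg: "0 \<le> x \<bullet> (G *v x)" for x
    using assms(2) order_trans[OF _ assms(3)[of x]] by simp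
  have "\<bar>column j X $ i\<bar> \<le> norm (column j X)" by (rule component_le_norm_cart)
  then have "(X $ i $ j)\<^sup>2 \<le> column j X \<bullet> column j X"
    by (simp add: column_def power2_norm_eq_inner[symmetric] abs_le_square_iff[symmetric])
  then have "g * (X $ i $ j)\<^sup>2 \<le> column j X \<bullet> (G *v column j X)"
    using assms(2) by (intro order_trans[OF mult_left_mono assms(3)]) auto
  then have "\<Lambda> $ j $ j * (g * (X $ i $ j)\<^sup>2) \<le> \<Lambda> $ j $ j * (column j X \<bullet> (G *v column j X))"
    using assms(1)[of j] by (intro mult_left_mono) auto
  also have "\<dots> \<le> lyapunov \<Lambda> G X"
    unfolding lyapunov_def
    by (rule member_le_sum) (auto intro!: mult_nonneg_nonneg nonneg less_imp_le[OF assms(1)])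
  finally show ?thesis .
qed

lemma bounded_mat_seq_if_lyapunov_bounded:
  fixes \<Lambda> :: "real^'m^'m" and G :: "real^'r^'r"
  assumes "\<And>i. 0 < \<Lambda> $ i $ i" and "0 < g" and "\<And>x. g * (x \<bullet> x) \<le> x \<bullet> (G *v x)"
    and V: "\<And>k. lyapunov \<Lambda> G (X k) \<le> V"
  shows "bounded_mat_seq X"
proof -
  \<comment> \<open>Summing over the columns gives one constant valid for every
    \<open>j\<close>.\<close>
  define b where "b = (\<Sum>j\<in>UNIV. \<bar>V\<bar> / (\<Lambda> $ j $ j * g))"
  have pos: "0 < \<Lambda> $ j $ j * g" for j using assms by simp
  \<comment> \<open>\<open>b + 1\<close> stands in for a square root of \<open>b\<close>, since its
    square is at least \<open>b\<close>.\<close>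
  have "\<bar>X k $ i $ j\<bar> \<le> b + 1" for k i j
  proof -
    have "\<Lambda> $ j $ j * g * (X k $ i $ j)\<^sup>2 \<le> V"
      using order_trans[OF lyapunov_lower_bound[OF assms(1-3)] V, of j k i] by (simp add: mult.assoc)
    then have "(X k $ i $ j)\<^sup>2 \<le> \<bar>V\<bar> / (\<Lambda> $ j $ j * g)"
      using pos[of j] by (simp add: pos_le_divide_eq mult.commute)
    also have "\<dots> \<le> b"
      unfolding b_def by (rule member_le_sum) (auto intro!: divide_nonneg_pos pos)
    finally have le: "(X k $ i $ j)\<^sup>2 \<le> b" .
    then have "0 \<le> b" using zero_le_power2 order_trans by blast
    then have "(X k $ i $ j)\<^sup>2 \<le> (b + 1)\<^sup>2"
      using le by (simp add: power2_eq_square algebra_simps) (smt (verit) mult_nonneg_nonneg)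
    then show ?thesis using \<open>0 \<le> b\<close> by (intro power2_le_imp_le[of "\<bar>X k $ i $ j\<bar>"]) auto
  qed
  then show ?thesis unfolding bounded_mat_seq_iff by blast
qed

text \<open>Telescoping bounds the partial sums of \<open>d\<close> by \<open>V 0\<close>; the
  series converges and its terms vanish.\<close>

lemma tendsto_0_if_decrease:
  fixes V d :: "nat \<Rightarrow> real"
  assumes dec: "\<And>k. V (Suc k) \<le> V k - d k" and "\<And>k. 0 \<le> V k" "\<And>k. 0 \<le> d k"
  shows "d \<longlonglongrightarrow> 0"
proof (rule summable_LIMSEQ_zero, rule bounded_imp_summable)
  have "(\<Sum>i<n. d i) \<le> V 0 - V n" for n
  proof (induction n)
    case (Suc n)
    with dec[of n] show ?case by simp
  qed simp
  then show "sum d {..n} \<le> V 0" for n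
    unfolding lessThan_Suc_atMost[symmetric] using assms(2)[of "Suc n"] by (smt (verit))
qed (rule assms)

text \<open>Positivity passes to the inverse through
  \<open>x^T G x = (G x)^T \<Gamma> (G x)\<close>; symmetry holds because \<open>G^T\<close> is
  another left inverse of \<open>\<Gamma>\<close>.\<close>

lemma symmetric_positive_definite_inverse:
  fixes \<Gamma> :: "real^'r^'r"
  assumes sym: "transpose \<Gamma> = \<Gamma>" and pd: "\<And>x. x \<noteq> 0 \<Longrightarrow> 0 < x \<bullet> (\<Gamma> *v x)"
  obtains G where "transpose G = G" "G ** \<Gamma> = mat 1" "\<And>x. x \<noteq> 0 \<Longrightarrow> 0 < x \<bullet> (G *v x)"
proof -
  have "x = 0" if "\<Gamma> *v x = 0" for x using pd[of x] that by auto
  then have "invertible \<Gamma>"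
    by (simp add: invertible_left_inverse matrix_left_invertible_ker)
  then obtain G where G: "G ** \<Gamma> = mat 1" "\<Gamma> ** G = mat 1" unfolding invertible_def by blast
  have "transpose G ** \<Gamma> = mat 1"
    using arg_cong[OF G(2), of transpose] by (simp add: matrix_transpose_mul sym transpose_mat)
  then have "transpose G = G"
    using G(2) by (metis matrix_mul_assoc matrix_mul_lid matrix_mul_rid)
  moreover have "0 < x \<bullet> (G *v x)" if "x \<noteq> 0" for x
  proof -
    have x: "x = \<Gamma> *v (G *v x)" by (simp add: matrix_vector_mul_assoc G)
    then have "G *v x \<noteq> 0" using that by force
    from pd[OF this] show ?thesis using x by (simp add: inner_commute)
  qed
  ultimately show thesis using that G(1) by blast
qed

theorem theorem3:
  fixes B :: "real^'m^'r" and \<Lambda> :: "real^'m^'m"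
    and A\<^sub>m \<Gamma> :: "real^'r^'r" and l :: real
    and v \<xi> \<xi>\<^sub>m\<^sub>1 e\<^sub>1 :: "nat \<Rightarrow> real^'r"
    and u :: "nat \<Rightarrow> real^'m"
    and \<epsilon> :: "nat \<Rightarrow> real^'r"
    and \<sigma> :: "nat \<Rightarrow> real"
    and \<theta>\<^sub>v :: "nat \<Rightarrow> real^'m^'r"
  assumes "CARD('r) < CARD('m)"
    and "rank B = CARD('r)"
    and "\<forall>i j. i \<noteq> j \<longrightarrow> \<Lambda> $ i $ j = 0"
    and "\<forall>i. 0 < \<Lambda> $ i $ i \<and> \<Lambda> $ i $ i \<le> 1"
    and "bounded_vec_seq v"
    and "\<forall>z. is_eigenvalue (complexify A\<^sub>m) z \<longrightarrow> cmod z < 1"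
    and "assumption1 (A\<^sub>m + l *\<^sub>R mat 1) (B ** \<Lambda>)"
    and "assumption1 (A\<^sub>m - l *\<^sub>R mat 1) (B ** \<Lambda>)"
    and "transpose \<Gamma> = \<Gamma>"
    and "\<forall>x. x \<noteq> 0 \<longrightarrow> 0 < x \<bullet> (\<Gamma> *v x)"
    and "\<forall>k. u k = transpose (\<theta>\<^sub>v k) *v v k"
    and "\<forall>k. \<xi> (Suc k) = A\<^sub>m *v \<xi> k + (B ** \<Lambda>) *v u k - v k"
    and "\<forall>k. \<xi>\<^sub>m\<^sub>1 (Suc k) = A\<^sub>m *v \<xi>\<^sub>m\<^sub>1 k - l *\<^sub>R (\<xi> k - \<xi>\<^sub>m\<^sub>1 k)"
    and "\<forall>k. e\<^sub>1 k = \<xi> k - \<xi>\<^sub>m\<^sub>1 k"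
    and "\<forall>k. \<sigma> k = sqrt (1 + lambda_max (B ** \<Lambda> ** transpose B) * (v k \<bullet> (\<Gamma> *v v k)))"
    and "\<forall>k. \<epsilon> k = (1 / (\<sigma> k)\<^sup>2) *\<^sub>R (v k - (B ** \<Lambda>) *v u k)"
    and "\<forall>k. \<theta>\<^sub>v (Suc k) = \<theta>\<^sub>v k + \<Gamma> ** outer (v k) (\<epsilon> k) ** B"
  shows "(\<forall>k. e\<^sub>1 (Suc k) = (A\<^sub>m + l *\<^sub>R mat 1) *v e\<^sub>1 k +
             (B ** \<Lambda>) *v (transpose (\<theta>\<^sub>v k - ideal_parameter B \<Lambda>) *v v k))
    \<and> bounded_mat_seq \<theta>\<^sub>v \<and> bounded_vec_seq e\<^sub>1 \<and> bounded_vec_seq \<xi> \<and> bounded_vec_seq \<xi>\<^sub>m\<^sub>1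
    \<and> bounded_vec_seq u \<and> bounded_vec_seq \<epsilon>
    \<and> e\<^sub>1 \<longlonglongrightarrow> 0"
proof -
  let ?P = "B ** \<Lambda>"
  let ?S = "B ** \<Lambda> ** transpose B"
  let ?M = "A\<^sub>m + l *\<^sub>R mat 1"
  note rank = assms(2) and diag = assms(3) and A\<^sub>m = assms(6) and law = assms(17)
  note u = assms(11)[rule_format] and \<xi> = assms(12)[rule_format] and \<xi>\<^sub>m\<^sub>1 = assms(13)[rule_format]
    and e\<^sub>1 = assms(14)[rule_format] and \<sigma> = assms(15)[rule_format] and \<epsilon> = assms(16)[rule_format]
  have pos: "\<And>i. 0 < \<Lambda> $ i $ i" using assms(4) by blast
  have pd: "\<And>x. x \<noteq> 0 \<Longrightarrow> 0 < x \<bullet> (\<Gamma> *v x)" using assms(10) by blast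
  define \<theta>' where "\<theta>' k = \<theta>\<^sub>v k - ideal_parameter B \<Lambda>" for k
  define w where "w k = ?P *v (transpose (\<theta>' k) *v v k)" for k
  define L where "L = lambda_max ?S"

  have inv: "?P *v (transpose (ideal_parameter B \<Lambda>) *v x) = x" for x
    by (rule ideal_parameter_right_inverse[OF rank diag pos])
  \<comment> \<open>By \<open>inv\<close> the ideal parameter contributes exactly
    \<open>v k\<close>, so the forcing term is minus the numerator of
    \<open>\<epsilon>\<close>.\<close>
  have w: "w k = ?P *v u k - v k" for k
  proof -
    have "transpose (\<theta>' k) = transpose (\<theta>\<^sub>v k) - transpose (ideal_parameter B \<Lambda>)"
      by (simp add: \<theta>'_def vec_eq_iff Finite_Cartesian_Product.transpose_def)
    then show ?thesis
      unfolding w_def u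
      by (simp only: matrix_vector_mult_diff_rdistrib matrix_vector_mult_diff_distrib inv)
  qed
  have e\<^sub>1_rec: "e\<^sub>1 (Suc k) = ?M *v e\<^sub>1 k + w k" for k
    unfolding w e\<^sub>1 \<xi> \<xi>\<^sub>m\<^sub>1
    by (simp add: matrix_vector_mult_add_rdistrib matrix_vector_mult_diff_distrib
        scaleR_matrix_vector_assoc[symmetric] algebra_simps)

  \<comment> \<open>The normalization \<open>\<sigma>\<close>\<close>
  have quad_S: "x \<bullet> (?S *v x) \<le> L * (x \<bullet> x)" for x
    unfolding L_def
    by (rule rayleigh_le_lambda_max)
      (simp add: matrix_transpose_mul transpose_diagonal[OF diag] matrix_mul_assoc)
  have "0 \<le> x \<bullet> (?S *v x)" for x
  proof -
    have "x \<bullet> (?S *v x) = (transpose B *v x) \<bullet> (\<Lambda> *v (transpose B *v x))"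
      by (metis dot_lmul_matrix matrix_vector_mul_assoc transpose_matrix_vector)
    then show ?thesis
      by (simp add: inner_diagonal_sum[OF diag] sum_nonneg less_imp_le[OF pos])
  qed
  \<comment> \<open>Any unit vector, here \<open>axis undefined 1\<close>, reveals the sign of
    \<open>L\<close>. With it the radicand of \<open>\<sigma>\<close> is nonnegative and squaring
    removes the root.\<close>
  from order_trans[OF this quad_S, of "axis undefined 1"] have "0 \<le> L"
    by (simp add: inner_axis_axis)
  moreover have quad_v: "0 \<le> v k \<bullet> (\<Gamma> *v v k)" for k
    using pd[of "v k"] by (cases "v k = 0") auto
  ultimately have \<sigma>2: "(\<sigma> k)\<^sup>2 = 1 + L * (v k \<bullet> (\<Gamma> *v v k))" for k
    unfolding \<sigma> L_def[symmetric] by simp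
  have \<sigma>2_ge: "1 \<le> (\<sigma> k)\<^sup>2" for k
    using \<open>0 \<le> L\<close> quad_v by (simp add: \<sigma>2)
  have w_\<epsilon>: "w k = - ((\<sigma> k)\<^sup>2 *\<^sub>R \<epsilon> k)" for k
    using \<sigma>2_ge[of k] by (auto simp: w \<epsilon>)

  \<comment> \<open>Decrease of the Lyapunov function\<close>
  obtain G where G: "transpose G = G" "G ** \<Gamma> = mat 1" "\<And>x. x \<noteq> 0 \<Longrightarrow> 0 < x \<bullet> (G *v x)"
    using symmetric_positive_definite_inverse[OF assms(9) pd, of thesis] by blast
  obtain g where g: "0 < g" "\<And>x. g * (x \<bullet> x) \<le> x \<bullet> (G *v x)"
    using positive_definite_coercive[OF G(3), of thesis] by blast
  define V where "V k = lyapunov \<Lambda> G (\<theta>' k)" for k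
  \<comment> \<open>The cross term is \<open>-2 \<sigma>^2 |\<epsilon>|^2\<close> and the quadratic
    term at most \<open>(\<sigma>^2 - 1) |\<epsilon>|^2\<close>; of the resulting drop only
    \<open>|\<epsilon>|^2\<close> is kept.\<close>
  have dec: "V (Suc k) \<le> V k - \<epsilon> k \<bullet> \<epsilon> k" for k
  proof -
    have "\<theta>' (Suc k) = \<theta>' k + \<Gamma> ** outer (v k) (\<epsilon> k) ** B"
      by (simp add: \<theta>'_def law)
    then have "V (Suc k) = V k + 2 * (\<epsilon> k \<bullet> w k)
        + (v k \<bullet> (\<Gamma> *v v k)) * (\<epsilon> k \<bullet> (?S *v \<epsilon> k))"
      unfolding V_def w_def by (simp add: lyapunov_update[OF diag G(1,2)])
    moreover have "(v k \<bullet> (\<Gamma> *v v k)) * (\<epsilon> k \<bullet> (?S *v \<epsilon> k))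
        \<le> (v k \<bullet> (\<Gamma> *v v k)) * (L * (\<epsilon> k \<bullet> \<epsilon> k))"
      by (rule mult_left_mono[OF quad_S quad_v])
    moreover have "\<dots> = ((\<sigma> k)\<^sup>2 - 1) * (\<epsilon> k \<bullet> \<epsilon> k)" by (simp add: \<sigma>2)
    moreover have "\<epsilon> k \<bullet> w k = - ((\<sigma> k)\<^sup>2 * (\<epsilon> k \<bullet> \<epsilon> k))" by (simp add: w_\<epsilon>)
    moreover have "0 \<le> (\<sigma> k)\<^sup>2 * (\<epsilon> k \<bullet> \<epsilon> k)" by simp
    ultimately show ?thesis
      by (simp only: left_diff_distrib mult_1 mult_minus_right)
  qed
  have "V k \<le> V 0" for k
  proof (induction k)
    case (Suc k)
    with dec[of k] show ?case using inner_ge_zero[of "\<epsilon> k"] by linarith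
  qed simp
  then have "bounded_mat_seq \<theta>'"
    unfolding V_def by (rule bounded_mat_seq_if_lyapunov_bounded[OF pos g])
  then have \<theta>_bdd: "bounded_mat_seq \<theta>\<^sub>v"
    unfolding \<theta>'_def by (rule bounded_mat_seq_add_const)
  have "0 \<le> V k" for k
    using order_trans[OF _ lyapunov_lower_bound[OF pos g]] pos g(1)
    unfolding V_def by (simp add: less_imp_le)
  with dec have "(\<lambda>k. \<epsilon> k \<bullet> \<epsilon> k) \<longlonglongrightarrow> 0"
    by (rule tendsto_0_if_decrease) simp
  then have "(\<lambda>k. sqrt (\<epsilon> k \<bullet> \<epsilon> k)) \<longlonglongrightarrow> 0"
    using tendsto_real_sqrt by fastforce
  then have \<epsilon>_lim: "\<epsilon> \<longlonglongrightarrow> 0"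
    by (simp add: norm_eq_sqrt_inner[symmetric] tendsto_norm_zero_iff)

  \<comment> \<open>Bounded input and vanishing forcing term\<close>
  have v_bdd: "Bseq v" using assms(5) by (simp add: bounded_vec_seq_iff_Bseq)
  have u_bdd: "Bseq u"
    using Bseq_matrix_vector_mult[OF bounded_mat_seq_transpose[OF \<theta>_bdd] v_bdd]
    by (simp only: u[symmetric])
  have "Bseq (\<lambda>k. (\<sigma> k)\<^sup>2)"
  proof -
    obtain a where a: "\<And>k. norm (v k) \<le> a" using BseqD[OF v_bdd] by blast
    obtain b where b: "\<And>k. norm (\<Gamma> *v v k) \<le> b"
      using BseqD[OF Bseq_const_matrix_vector_mult[OF v_bdd, of \<Gamma>]] by blast
    have "v k \<bullet> (\<Gamma> *v v k) \<le> a * b" for k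
      by (rule order_trans[OF norm_cauchy_schwarz mult_mono])
        (auto intro: a b order_trans[OF norm_ge_zero a])
    then have "(\<sigma> k)\<^sup>2 \<le> 1 + L * (a * b)" for k
      unfolding \<sigma>2 using \<open>0 \<le> L\<close> by (simp add: mult_left_mono)
    then show ?thesis by (intro BseqI') simp
  qed
  then obtain s where s: "\<And>k. (\<sigma> k)\<^sup>2 \<le> s" using BseqD by force
  \<comment> \<open>\<open>w_\<epsilon>\<close> expresses \<open>w\<close> through
    \<open>\<epsilon>\<close> with the factor \<open>\<sigma>^2\<close>, which \<open>s\<close>
    bounds uniformly.\<close>
  have w_lim: "w \<longlonglongrightarrow> 0"
  proof (rule tendsto_0_le[OF \<epsilon>_lim, of _ s])
    show "\<forall>\<^sub>F k in sequentially. norm (w k) \<le> norm (\<epsilon> k) * s"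
      by (rule always_eventually)
        (simp add: w_\<epsilon> mult.commute[of "norm _"] mult_right_mono s)
  qed

  \<comment> \<open>Stability of the error dynamics and the remaining signals\<close>
  have "surj ((*v) ?P)" using inv by (metis surjI)
  then obtain R where "?P ** R = mat 1" by (auto simp: matrix_right_invertible_surjective[symmetric])
  from controllable_subspace_UNIV[OF this]
  have "controllable_mode ?M ?P z \<longleftrightarrow> is_eigenvalue (complexify ?M) z" for z
    by (simp add: controllable_mode_def is_eigenvalue_def)
  \<comment> \<open>Every eigenvalue is a controllable mode, so the strict bound in part (ii) of
    Assumption 1 covers the whole spectrum.\<close>
  then have M: "cmod z < 1" if "is_eigenvalue (complexify ?M) z" for z
    using assms(7) that unfolding assumption1_def by blast
  have e\<^sub>1_lim: "e\<^sub>1 \<longlonglongrightarrow> 0"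
    by (rule stable_recursion_tendsto_0[OF M e\<^sub>1_rec w_lim])
  then have e\<^sub>1_bdd: "Bseq e\<^sub>1" by (intro convergent_imp_Bseq convergentI)
  \<comment> \<open>Here the Schur stable matrix is \<open>A\<^sub>m\<close> itself, and the input
    is bounded because \<open>u\<close> and \<open>v\<close> are.\<close>
  have \<xi>_bdd: "Bseq \<xi>"
  proof (rule stable_recursion_Bseq)
    show "\<xi> (Suc k) = A\<^sub>m *v \<xi> k + (?P *v u k - v k)" for k by (simp add: \<xi>)
    show "Bseq (\<lambda>k. ?P *v u k - v k)"
      by (intro Bseq_diff Bseq_const_matrix_vector_mult u_bdd v_bdd)
  qed (use A\<^sub>m in blast)
  have "\<xi>\<^sub>m\<^sub>1 = (\<lambda>k. \<xi> k - e\<^sub>1 k)" by (simp add: e\<^sub>1)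
  then have "Bseq \<xi>\<^sub>m\<^sub>1" using Bseq_diff[OF \<xi>_bdd e\<^sub>1_bdd] by simp
  moreover have "Bseq \<epsilon>" using \<epsilon>_lim by (intro convergent_imp_Bseq convergentI)
  ultimately show ?thesis
    unfolding bounded_vec_seq_iff_Bseq
    using e\<^sub>1_rec \<theta>_bdd e\<^sub>1_bdd \<xi>_bdd u_bdd e\<^sub>1_lim unfolding w_def \<theta>'_def by blast
qed

end
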